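(* Let $A\in\mathbb{R}^{n\times n}$, $B\in\mathbb{R}^{n\times m}$ with $(A,B)$ stabilizable, and consider the system $x_{k+1}=Ax_k+Bu_k$ with control policy $u_k=Kx_k$, $K\in\mathbb{R}^{m\times n}$. (i) Let $0<\lambda\le 1$ and let $\Gamma\in\mathbb{R}^{n\times n}$ with $\Gamma\succ 0$. Suppose there exist a symmetric positive definite $Y\in\mathbb{R}^{n\times n}$ and $F\in\mathbb{R}^{m\times n}$ such that $$\begin{bmatrix} \lambda Y & (Y-2\Gamma)^\top \\ Y-2\Gamma & Y\end{bmatrix}\succ 0\qquad\text{and}\qquad AY+BF=Y-2\Gamma .$$ Put $P=Y^{-1}$ and let $K$ be given by $F=KY$. Then the states of the closed-loop system descend along the gradient of $V_k=x_k^\top Px_k$ with step size (direction) matrix $\Gamma$, i.e. every closed-loop trajectory satisfies $$x_{k+1}=x_k-\Gamma\,\frac{\partial V_k}{\partial x_k};$$ moreover, the closed-loop system is $\lambda$-contractive and is parameterized by the triplet $(\Gamma,P,K)$, i.e. $A+BK=I-2\Gamma P$. (ii) For any stable control gain $K$ (i.e. any $K\in\mathbb{R}^{m\times n}$ such that $A+BK$ is stable) there exist a symmetric positive definite $P\in\mathbb{R}^{n\times n}$ and a positive definite, in general non-symmetric, $\Gamma\in\mathbb{R}^{n\times n}$ such that the closed-loop system is a trajectory-oriented gradient descent system, i.e. $A+BK=I-2\Gamma P$.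
   Context: States are $x_k\in\mathbb{R}^n$, inputs $u_k\in\mathbb{R}^m$, $k\in\mathbb{N}$. A trajectory-oriented gradient descent system is one of the form $x_{k+1}=x_k-\Gamma\,\partial V_k/\partial x_k$ with $V_k=x_k^\top Px_k$, $P$ symmetric positive definite and $\Gamma\succ0$; since $\partial V_k/\partial x_k=2Px_k$, this reads $x_{k+1}=(I-2\Gamma P)x_k$. The matrix $\Gamma$ is allowed to be non-symmetric, and $\Gamma\succ 0$ (positive definite) means $z^\top\Gamma z>0$ for all nonzero $z\in\mathbb{R}^n$. The closed-loop system is $x_{k+1}=(A+BK)x_k$; it is $\lambda$-contractive (with respect to $V_k=x_k^\top Px_k$) if $V_{k+1}\le\lambda V_k$ for every $x_k\in\mathbb{R}^n$. A matrix is stable if all its eigenvalues have modulus less than $1$; $(A,B)$ is stabilizable if $A+BK$ is stable for some $K$. *)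

theory Defs
  imports "HOL-Analysis.Analysis"
begin

text \<open>
  Matrices are not assumed symmetric here; symmetry is a separate hypothesis wherever it is wanted.
\<close>

definition pos_def :: "real^'n^'n \<Rightarrow> bool" where
  "pos_def M \<longleftrightarrow> (\<forall>z. z \<noteq> 0 \<longrightarrow> z \<bullet> (M *v z) > 0)"

definition symmetric_matrix :: "real^'n^'n \<Rightarrow> bool" where
  "symmetric_matrix M \<longleftrightarrow> transpose M = M"

definition block_matrix ::
  "'a^'c^'r \<Rightarrow> 'a^'d^'r \<Rightarrow> 'a^'c^'s \<Rightarrow> 'a^'d^'s \<Rightarrow> 'a^('c + 'd)^('r + 's)" where
  "block_matrix M11 M12 M21 M22 =
     (\<chi> i j. case i of
        Inl r \<Rightarrow> (case j of Inl c \<Rightarrow> M11 $ r $ c | Inr d \<Rightarrow> M12 $ r $ d)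
      | Inr s \<Rightarrow> (case j of Inl c \<Rightarrow> M21 $ s $ c | Inr d \<Rightarrow> M22 $ s $ d))"

definition is_eigenvalue :: "'a::field^'n^'n \<Rightarrow> 'a \<Rightarrow> bool" where
  "is_eigenvalue M e \<longleftrightarrow> (\<exists>v. v \<noteq> 0 \<and> M *v v = e *s v)"

text \<open>The eigenvalues of a real matrix are those of its complexification.\<close>

definition stable_matrix :: "real^'n^'n \<Rightarrow> bool" where
  "stable_matrix M \<longleftrightarrow> (\<forall>e. is_eigenvalue (map_matrix complex_of_real M) e \<longrightarrow> cmod e < 1)"

definition stabilizable :: "real^'n^'n \<Rightarrow> real^'m^'n \<Rightarrow> bool" where
  "stabilizable A B \<longleftrightarrow> (\<exists>K :: real^'n^'m. stable_matrix (A + B ** K))"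

definition closed_loop_trajectory ::
  "real^'n^'n \<Rightarrow> real^'m^'n \<Rightarrow> real^'n^'m \<Rightarrow> (nat \<Rightarrow> real^'n) \<Rightarrow> bool" where
  "closed_loop_trajectory A B K x \<longleftrightarrow>
     (\<exists>u. (\<forall>k. x (Suc k) = A *v x k + B *v u k) \<and> (\<forall>k. u k = K *v x k))"

definition quad_form :: "real^'n^'n \<Rightarrow> real^'n \<Rightarrow> real" where
  "quad_form P x = x \<bullet> (P *v x)"

definition contractive :: "real \<Rightarrow> real^'n^'n \<Rightarrow> (real^'n \<Rightarrow> real^'n) \<Rightarrow> bool" where
  "contractive l P f \<longleftrightarrow> (\<forall>x. quad_form P (f x) \<le> l * quad_form P x)"

text \<open>One step \<open>x\<^sup>+ = x - \<Gamma> \<nabla>V(x)\<close>; the gradient is unique, so the existential just names it.\<close>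

definition gradient_step :: "real^'n^'n \<Rightarrow> (real^'n \<Rightarrow> real) \<Rightarrow> real^'n \<Rightarrow> real^'n \<Rightarrow> bool" where
  "gradient_step G V x y \<longleftrightarrow> (\<exists>g. (GDERIV V x :> g) \<and> y = x - G *v g)"

text \<open>Trajectory-oriented gradient descent system \<open>x\<^sub>k\<^sub>+\<^sub>1 = f x\<^sub>k\<close>.\<close>

definition gradient_descent_system ::
  "real^'n^'n \<Rightarrow> real^'n^'n \<Rightarrow> (real^'n \<Rightarrow> real^'n) \<Rightarrow> bool" where
  "gradient_descent_system G P f \<longleftrightarrow>
     symmetric_matrix P \<and> pos_def P \<and> pos_def G \<and> (\<forall>x. gradient_step G (quad_form P) x (f x))"

end

theory Submission
  imports Defs "HOL-Complex_Analysis.Complex_Analysis"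
begin

text \<open>
  (i) The Schur complement of the block matrix with respect to its lower right block \<open>Y\<close> is the
  contraction inequality, after the substitution \<open>x = Y u\<close>; and multiplying
  \<open>A Y + B F = Y - 2 \<Gamma>\<close> by \<open>Y\<^sup>-\<^sup>1\<close> gives \<open>A + B K = I - 2 \<Gamma> P\<close>.

  (ii) For stable \<open>M = A + B K\<close> let \<open>P\<close> solve the Lyapunov equation \<open>P - M\<^sup>T P M = I\<close> and put
  \<open>\<Gamma> = (I - M) P\<^sup>-\<^sup>1 / 2\<close>. With \<open>z = P w\<close>, positivity of \<open>z \<bullet> \<Gamma> z\<close> means
  \<open>w \<bullet> P M w < w \<bullet> P w\<close>, which follows from \<open>0 \<le> V (w - M w)\<close> and \<open>V (M w) < V w\<close>. The series
  \<open>P = (\<Sum>k. (M\<^sup>k)\<^sup>T M\<^sup>k)\<close> converges because the Neumann series of the resolvent \<open>(I - z M)\<^sup>-\<^sup>1\<close> converges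
  absolutely at \<open>z = 1\<close>.
\<close>

section \<open>Absolute summability of the powers of a stable matrix\<close>

definition matrix_power :: "'a::semiring_1^'n^'n \<Rightarrow> nat \<Rightarrow> 'a^'n^'n" where
  "matrix_power M k = (((**) M) ^^ k) (mat 1)"

lemma matrix_power_0 [simp]: "matrix_power M 0 = mat 1"
  and matrix_power_Suc: "matrix_power M (Suc k) = M ** matrix_power M k"
  by (simp_all add: matrix_power_def)

text \<open>The recursion peels factors off on the left, while the Lyapunov shift needs the factor
  \<open>M\<close> next to the vector.\<close>

lemma matrix_power_Suc_right: "matrix_power M (Suc k) = matrix_power M k ** M"
proof (induction k)
  case (Suc k)
  have "matrix_power M (Suc (Suc k)) = M ** (matrix_power M k ** M)"
    by (simp only: matrix_power_Suc[of M "Suc k"] Suc)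
  then show ?case by (simp add: matrix_mul_assoc matrix_power_Suc)
qed (simp add: matrix_power_Suc)

text \<open>Brings summability, proved over the complex numbers where the eigenvalues live, back to
  real powers.\<close>

lemma map_matrix_of_real_power:
  "matrix_power (map_matrix complex_of_real M) k = map_matrix complex_of_real (matrix_power M k)"
  by (induction k)
     (simp_all add: matrix_power_Suc vec_eq_iff map_matrix_def mat_def matrix_matrix_mult_def)

text \<open>This is I - z C, the matrix whose inverse is the resolvent; written entrywise, each
  entry is visibly affine in \<open>z\<close>.\<close>

definition resolvent_matrix :: "'a::comm_ring_1^'n^'n \<Rightarrow> 'a \<Rightarrow> 'a^'n^'n" where
  "resolvent_matrix C z = (\<chi> i j. (if i = j then 1 else 0) - z * C $ i $ j)"

lemma resolvent_matrix_mult_vec: "resolvent_matrix C z *v v = v - z *s (C *v v)"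
proof -
  have "(resolvent_matrix C z *v v) $ i = (v - z *s (C *v v)) $ i" for i
  proof -
    have "(resolvent_matrix C z *v v) $ i
      = (\<Sum>j\<in>UNIV. (if i = j then v $ j else 0) - z * (C $ i $ j * v $ j))"
      unfolding resolvent_matrix_def matrix_vector_mult_def
      by (auto intro!: sum.cong simp: algebra_simps)
    also have "\<dots> = v $ i - z * (\<Sum>j\<in>UNIV. C $ i $ j * v $ j)"
      by (simp add: sum_subtractf sum_distrib_left)
    finally show ?thesis by (simp add: matrix_vector_mult_def)
  qed
  then show ?thesis by (simp add: vec_eq_iff)
qed

text \<open>A kernel vector satisfies \<open>v = z *s (C *v v)\<close>, so \<open>z\<close> is
  nonzero and \<open>1 / z\<close> is an eigenvalue of modulus at least 1.\<close>

lemma det_resolvent_matrix_nonzero: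
  fixes C :: "complex^'n^'n"
  assumes "\<And>e. is_eigenvalue C e \<Longrightarrow> cmod e < 1" and "cmod z \<le> 1"
  shows "det (resolvent_matrix C z) \<noteq> 0"
proof
  assume "det (resolvent_matrix C z) = 0"
  then have "\<not> invertible (resolvent_matrix C z)"
    by (simp add: invertible_det_nz)
  then obtain v where v: "v \<noteq> 0" "resolvent_matrix C z *v v = 0"
    unfolding invertible_left_inverse matrix_left_invertible_ker by blast
  then have eq: "v = z *s (C *v v)" by (simp add: resolvent_matrix_mult_vec)
  with v(1) have "z \<noteq> 0" by auto
  then have "C *v v = (1 / z) *s v" by (subst eq) simp
  then have "is_eigenvalue C (1 / z)" using v(1) unfolding is_eigenvalue_def by blast
  then have "cmod (1 / z) < 1" by (rule assms(1))
  with \<open>z \<noteq> 0\<close> assms(2) show False by (simp add: norm_divide divide_simps)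
qed

lemma holomorphic_on_det:
  fixes M :: "complex \<Rightarrow> complex^'n^'n"
  assumes "\<And>i j. (\<lambda>z. M z $ i $ j) holomorphic_on S"
  shows "(\<lambda>z. det (M z)) holomorphic_on S"
  unfolding det_def by (intro holomorphic_intros assms)

text \<open>By Cramer's rule the resolvent is holomorphic on a disc of radius larger than one, and its
  power series there is the Neumann series.\<close>

lemma summable_matrix_power_entry:
  fixes C :: "complex^'n^'n"
  assumes stable: "\<And>e. is_eigenvalue C e \<Longrightarrow> cmod e < 1"
  shows "summable (\<lambda>k. norm (matrix_power C k $ i $ j))"
proof -
  define D where "D z = det (resolvent_matrix C z)" for z
  define b :: "complex^'n" where "b = axis j 1"
  \<comment> \<open>Cramer's formula for the solution of
    \<open>resolvent_matrix C z *v y = b\<close>: where \<open>D z\<close> is nonzero,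
    \<open>x z l\<close> is the entry (\<open>l\<close>, \<open>j\<close>) of the resolvent.\<close>
  define x where "x z l = det (\<chi> p q. if q = l then b $ p else resolvent_matrix C z $ p $ q) / D z"
    for z l
  have hol_D: "D holomorphic_on S" for S
    unfolding D_def by (intro holomorphic_on_det) (auto simp: resolvent_matrix_def intro!: holomorphic_intros)
  have "open {z. D z \<noteq> 0}"
    using holomorphic_on_imp_continuous_on[OF hol_D, of UNIV]
    by (intro open_Collect_neq) auto
  moreover have "cball 0 1 \<subseteq> {z. D z \<noteq> 0}"
    using det_resolvent_matrix_nonzero[of C] stable by (simp add: D_def subset_iff)
  \<comment> \<open>Compactness of the closed unit disc gives a uniform margin, so the determinant
    stays nonzero up to radius \<open>1 + e\<close>.\<close>
  ultimately obtain e where e: "e > 0" "(\<Union>z\<in>cball 0 1. ball z e) \<subseteq> {z. D z \<noteq> 0}"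
    using compact_subset_open_imp_ball_epsilon_subset[of "cball (0::complex) 1"] by auto
  define R where "R = 1 + e"
  have D_nz: "D z \<noteq> 0" if "z \<in> ball 0 R" for z
  proof -
    have "\<exists>w\<in>cball 0 1. z \<in> ball w e"
    proof (cases "cmod z \<le> 1")
      case True
      then show ?thesis using e(1) by (intro bexI[of _ z]) auto
    next
      case False
      \<comment> \<open>Outside the closed disc, the nearest point of the disc is the radial
        projection \<open>sgn z\<close>.\<close>
      have "dist (sgn z) z = cmod (of_real (1 / cmod z - 1) * z)"
        by (simp add: dist_norm sgn_eq algebra_simps divide_simps)
      also have "\<dots> = cmod z - 1"
        using False by (subst norm_mult) (auto simp: norm_of_real abs_if divide_simps simp del: of_real_diff)
      finally have "dist (sgn z) z < e" using that by (simp add: R_def)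
      then show ?thesis by (intro bexI[of _ "sgn z"]) (auto simp: norm_sgn)
    qed
    then show ?thesis using e(2) by blast
  qed
  have "(\<lambda>z. if q = l then b $ p else resolvent_matrix C z $ p $ q) holomorphic_on ball 0 R"
    for l p q
    by (cases "q = l") (auto simp: resolvent_matrix_def intro!: holomorphic_intros)
  then have hol_x: "(\<lambda>z. x z l) holomorphic_on ball 0 R" for l
    unfolding x_def
    by (intro holomorphic_on_divide hol_D holomorphic_on_det D_nz) simp_all
  define a where "a l = fps_expansion (\<lambda>z. x z l) 0" for l
  have R: "R > 1" using e(1) by (simp add: R_def)
  have exp: "(\<lambda>z. x z l) has_fps_expansion a l" for l
    unfolding a_def
    by (rule has_fps_expansion_fps_expansion[OF open_ball _ hol_x]) (use R in auto)
  have eq: "x z l - z * (\<Sum>m\<in>UNIV. C $ l $ m * x z m) = b $ l" if "z \<in> ball 0 R" for z l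
  proof -
    have "resolvent_matrix C z *v (\<chi> l. x z l) = b"
      using D_nz[OF that] unfolding x_def D_def by (subst cramer) auto
    then have "((\<chi> l. x z l) - z *s (C *v (\<chi> l. x z l))) $ l = b $ l"
      by (simp add: resolvent_matrix_mult_vec)
    then show ?thesis by (simp add: matrix_vector_mult_def)
  qed
  \<comment> \<open>The linear system for \<open>x\<close> becomes the formal identity a = b + X C
    a, since a function has only one expansion at 0.\<close>
  have a_eq: "a l - fps_X * (\<Sum>m\<in>UNIV. fps_const (C $ l $ m) * a m) = fps_const (b $ l)" for l
  proof (rule fps_expansion_unique_complex)
    show "(\<lambda>z. x z l - z * (\<Sum>m\<in>UNIV. C $ l $ m * x z m)) has_fps_expansion
        a l - fps_X * (\<Sum>m\<in>UNIV. fps_const (C $ l $ m) * a m)"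
      by (intro fps_expansion_intros exp)
    have ev: "eventually (\<lambda>z. x z l - z * (\<Sum>m\<in>UNIV. C $ l $ m * x z m) = b $ l) (nhds 0)"
      using R by (intro eventually_mono[OF eventually_nhds_in_open[of "ball 0 R"] eq]) auto
    show "(\<lambda>z. x z l - z * (\<Sum>m\<in>UNIV. C $ l $ m * x z m)) has_fps_expansion fps_const (b $ l)"
      by (subst has_fps_expansion_cong[OF ev refl]) simp
  qed
  \<comment> \<open>Comparing coefficients gives the starting value \<open>b\<close> and then one
    factor \<open>C\<close> per degree: the recursion for column \<open>j\<close> of the
    powers.\<close>
  have coeff: "fps_nth (a l) k = matrix_power C k $ l $ j" for l k
  proof (induction k arbitrary: l)
    case 0
    show ?case using arg_cong[OF a_eq[of l], of "\<lambda>f. fps_nth f 0"]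
      by (simp add: b_def mat_def axis_def)
  next
    case (Suc k)
    have "fps_nth (a l) (Suc k) = (\<Sum>m\<in>UNIV. C $ l $ m * fps_nth (a m) k)"
      using arg_cong[OF a_eq[of l], of "\<lambda>f. fps_nth f (Suc k)"]
      by (simp add: fps_sum_nth)
    then show ?case by (simp add: Suc matrix_power_Suc matrix_matrix_mult_def)
  qed
  \<comment> \<open>Since \<open>R > 1\<close>, the point 1 lies strictly inside the disc of
    convergence, where convergence is absolute.\<close>
  have "fps_conv_radius (a i) \<ge> ereal R"
    unfolding a_def by (rule conv_radius_fps_expansion) (use hol_x in simp)
  moreover have "ereal (norm (1::complex)) < ereal R" using R by simp
  ultimately have "ereal (norm (1::complex)) < fps_conv_radius (a i)" by (rule less_le_trans[rotated])
  from norm_summable_fps[OF this] show ?thesis by (simp add: coeff)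
qed

lemma stable_matrix_summable:
  fixes M :: "real^'n^'n"
  assumes "stable_matrix M"
  shows "summable (\<lambda>k. \<bar>matrix_power M k $ i $ j\<bar>)"
  using summable_matrix_power_entry[of "map_matrix complex_of_real M" i j] assms
  unfolding stable_matrix_def map_matrix_of_real_power by (simp add: map_matrix_def)

section \<open>The Lyapunov equation\<close>

lemma summable_mult_of_abs_summable:
  fixes f g :: "nat \<Rightarrow> real"
  assumes "summable (\<lambda>k. \<bar>f k\<bar>)" "summable (\<lambda>k. \<bar>g k\<bar>)"
  shows "summable (\<lambda>k. f k * g k)"
proof -
  \<comment> \<open>The terms of a convergent series tend to zero and are therefore bounded, so a
    multiple of \<open>\<bar>g k\<bar>\<close> dominates the product.\<close>
  have "Bseq f"
    using assms(1) by (metis convergent_imp_Bseq summable_LIMSEQ_zero convergentI summable_rabs_cancel)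
  then obtain K where K: "\<And>k. \<bar>f k\<bar> \<le> K" by (auto simp: Bseq_def)
  show ?thesis
  proof (rule summable_comparison_test')
    show "summable (\<lambda>k. K * \<bar>g k\<bar>)" by (intro summable_mult assms)
    show "norm (f k * g k) \<le> K * \<bar>g k\<bar>" for k
      by (simp add: abs_mult mult_right_mono K)
  qed
qed

lemma inner_matrix_eq_sum:
  "x \<bullet> (P *v y) = (\<Sum>i\<in>UNIV. \<Sum>j\<in>UNIV. x $ i * (P $ i $ j * y $ j))" for P :: "real^'n^'m"
  by (simp add: inner_vec_def matrix_vector_mult_def sum_distrib_left)

lemma transpose_inner: "x \<bullet> (transpose M *v y) = (M *v x) \<bullet> y" for M :: "real^'n^'m"
  by (metis dot_lmul_matrix transpose_matrix_vector inner_commute)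

lemma symmetric_matrix_inner:
  "symmetric_matrix P \<Longrightarrow> x \<bullet> (P *v y) = (P *v x) \<bullet> y"
  by (metis symmetric_matrix_def transpose_inner)

text \<open>Replacing \<open>w\<close> by \<open>M *v w\<close> shifts the series for
  \<open>quad_form P w\<close> by one term. This shift is the Lyapunov equation, stated here through
  its quadratic form.\<close>

lemma stable_matrix_Lyapunov:
  fixes M :: "real^'n^'n"
  assumes "stable_matrix M"
  obtains P where "symmetric_matrix P" "pos_def P"
    "\<And>w. quad_form P (M *v w) = quad_form P w - w \<bullet> w"
proof -
  define N where "N = matrix_power M"
  define t where "t k = transpose (N k) ** N k" for k
  define P :: "real^'n^'n" where "P = (\<chi> i j. \<Sum>k. t k $ i $ j)"
  \<comment> \<open>Each entry of \<open>t k\<close> is a finite sum of products of two entries of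
    the \<open>k\<close>-th power.\<close>
  have "summable (\<lambda>k. t k $ i $ j)" for i j
    unfolding t_def N_def matrix_matrix_mult_def transpose_def
    by (auto intro!: summable_sum summable_mult_of_abs_summable stable_matrix_summable assms)
  then have t_sums: "(\<lambda>k. t k $ i $ j) sums (P $ i $ j)" for i j
    by (simp add: P_def summable_sums)
  have P_sums: "(\<lambda>k. (N k *v x) \<bullet> (N k *v y)) sums (x \<bullet> (P *v y))" for x y
  proof -
    have "(\<lambda>k. x \<bullet> (t k *v y)) sums (x \<bullet> (P *v y))"
      unfolding inner_matrix_eq_sum by (intro sums_sum sums_mult sums_mult2 t_sums)
    then show ?thesis
      by (simp only: t_def matrix_vector_mul_assoc[symmetric] transpose_inner)
  qed
  have "t k $ i $ j = t k $ j $ i" for k i j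
    by (simp add: t_def matrix_matrix_mult_def transpose_def mult.commute)
  then have sym: "symmetric_matrix P"
    by (simp add: symmetric_matrix_def P_def transpose_def)
  have step: "quad_form P (M *v w) = quad_form P w - w \<bullet> w" for w
  proof -
    have "(\<lambda>k. (N (Suc k) *v w) \<bullet> (N (Suc k) *v w)) sums quad_form P (M *v w)"
      using P_sums[of "M *v w" "M *v w"]
      by (simp add: quad_form_def N_def matrix_power_Suc_right matrix_vector_mul_assoc)
    \<comment> \<open>Restoring the missing term at index 0, where the power is the identity, adds
      \<open>w \<bullet> w\<close>.\<close>
    then have "(\<lambda>k. (N k *v w) \<bullet> (N k *v w)) sums (quad_form P (M *v w) + w \<bullet> w)"
      by (subst (asm) sums_Suc_iff) (simp add: N_def)
    then show ?thesis
      using sums_unique2[OF P_sums[of w w]] by (simp add: quad_form_def)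
  qed
  have nonneg: "quad_form P w \<ge> 0" for w
    unfolding quad_form_def by (rule sums_le[OF _ sums_zero P_sums]) simp
  \<comment> \<open>The Lyapunov identity and nonnegativity at \<open>M *v w\<close> bound the form
    below by \<open>w \<bullet> w\<close>.\<close>
  have "quad_form P w > 0" if "w \<noteq> 0" for w
    using step[of w] nonneg[of "M *v w"] that inner_gt_zero_iff[of w] by linarith
  then have "pos_def P" by (simp add: pos_def_def quad_form_def)
  from that[OF sym this step] show thesis .
qed

section \<open>Inverses of positive definite matrices and gradients of quadratic forms\<close>

lemma pos_def_inverse:
  fixes Y :: "real^'n^'n"
  assumes "pos_def Y" "symmetric_matrix Y"
  shows "matrix_inv Y ** Y = mat 1" "Y ** matrix_inv Y = mat 1"
    "pos_def (matrix_inv Y)" "symmetric_matrix (matrix_inv Y)"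
proof -
  have "Y *v x = 0 \<Longrightarrow> x = 0" for x
    using assms(1) unfolding pos_def_def by (metis inner_zero_right less_irrefl)
  then have "invertible Y"
    unfolding invertible_left_inverse matrix_left_invertible_ker by blast
  then have inv: "Y ** matrix_inv Y = mat 1 \<and> matrix_inv Y ** Y = mat 1"
    unfolding matrix_inv_def invertible_def by (rule someI_ex)
  then show left: "matrix_inv Y ** Y = mat 1" and right: "Y ** matrix_inv Y = mat 1" by auto
  have Yinv: "Y *v (matrix_inv Y *v z) = z" for z
    by (simp add: matrix_vector_mul_assoc right)
  show "pos_def (matrix_inv Y)"
    unfolding pos_def_def
  proof (intro allI impI)
    fix z :: "real^'n" assume "z \<noteq> 0"
    then have "matrix_inv Y *v z \<noteq> 0" using Yinv[of z] by auto
    \<comment> \<open>The form of the inverse at \<open>z\<close> is the form of \<open>Y\<close> at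
      \<open>matrix_inv Y *v z\<close>.\<close>
    then have "0 < (matrix_inv Y *v z) \<bullet> (Y *v (matrix_inv Y *v z))"
      using assms(1) by (simp add: pos_def_def)
    then show "0 < z \<bullet> (matrix_inv Y *v z)" by (simp add: Yinv inner_commute)
  qed
  have "transpose (matrix_inv Y) = transpose (matrix_inv Y) ** (Y ** matrix_inv Y)"
    by (simp add: right)
  also have "\<dots> = transpose (Y ** matrix_inv Y) ** matrix_inv Y"
    using assms(2) by (simp add: matrix_transpose_mul matrix_mul_assoc symmetric_matrix_def)
  also have "\<dots> = matrix_inv Y" by (simp add: right)
  finally show "symmetric_matrix (matrix_inv Y)" by (simp add: symmetric_matrix_def)
qed

text \<open>The product rule yields two terms, which symmetry of \<open>P\<close> makes
  equal.\<close>

lemma GDERIV_quad_form: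
  assumes "symmetric_matrix P"
  shows "GDERIV (quad_form P) x :> 2 *\<^sub>R (P *v x)"
proof -
  have "((\<lambda>x. x \<bullet> (P *v x)) has_derivative (\<lambda>h. x \<bullet> (P *v h) + h \<bullet> (P *v x))) (at x)"
    by (intro has_derivative_inner has_derivative_ident bounded_linear_imp_has_derivative
        matrix_vector_mul_bounded_linear)
  moreover have "x \<bullet> (P *v h) + h \<bullet> (P *v x) = h \<bullet> (2 *\<^sub>R (P *v x))" for h
    using symmetric_matrix_inner[OF assms, of x h] by (simp add: inner_commute)
  ultimately show ?thesis by (simp add: gderiv_def quad_form_def[abs_def])
qed

lemma gradient_step_quad_form:
  assumes "symmetric_matrix P" "L = mat 1 - 2 *\<^sub>R (G ** P)"
  shows "gradient_step G (quad_form P) x (L *v x)"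
  unfolding gradient_step_def
proof (intro exI conjI)
  show "GDERIV (quad_form P) x :> 2 *\<^sub>R (P *v x)" by (rule GDERIV_quad_form[OF assms(1)])
  show "L *v x = x - G *v (2 *\<^sub>R (P *v x))"
    by (simp add: assms(2) matrix_vector_mult_diff_rdistrib scaleR_matrix_vector_assoc[symmetric]
        matrix_vector_mult_scaleR matrix_vector_mul_assoc)
qed

section \<open>Block matrices and the Schur complement\<close>

definition join_vec :: "'a^'n \<Rightarrow> 'a^'m \<Rightarrow> 'a^('n + 'm)" where
  "join_vec u v = (\<chi> i. case i of Inl r \<Rightarrow> u $ r | Inr s \<Rightarrow> v $ s)"

lemma sum_UNIV_Plus:
  "(\<Sum>i\<in>(UNIV :: ('n::finite + 'm::finite) set). f i) = (\<Sum>r\<in>UNIV. f (Inl r)) + (\<Sum>s\<in>UNIV. f (Inr s))"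
  using sum.Plus[of "UNIV :: 'n set" "UNIV :: 'm set" f] by (simp add: comp_def)

lemma inner_join_vec: "join_vec u v \<bullet> join_vec u' v' = u \<bullet> u' + v \<bullet> v'"
  by (simp add: inner_vec_def join_vec_def sum_UNIV_Plus)

lemma block_matrix_join_vec:
  "block_matrix M11 M12 M21 M22 *v join_vec u v
    = join_vec (M11 *v u + M12 *v v) (M21 *v u + M22 *v v)"
  by (auto simp: vec_eq_iff block_matrix_def join_vec_def matrix_vector_mult_def sum_UNIV_Plus
      split: sum.split)

text \<open>With lower component \<open>- (P *v (W *v u))\<close> the lower block row cancels, and
  the block form reduces to that of the Schur complement l Y - W^T P W at \<open>u\<close>.\<close>

lemma pos_def_block_matrix_Schur:
  fixes Y W :: "real^'n^'n"
  assumes "pos_def (block_matrix (l *\<^sub>R Y) (transpose W) W Y)" "Y ** P = mat 1" "u \<noteq> 0"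
  shows "quad_form P (W *v u) < l * quad_form Y u"
proof -
  define v where "v = - (P *v (W *v u))"
  have "join_vec u v \<noteq> 0"
    using inner_join_vec[of u v u v] assms(3) by (auto simp: add_nonneg_eq_0_iff)
  then have "0 < join_vec u v \<bullet>
      (block_matrix (l *\<^sub>R Y) (transpose W) W Y *v join_vec u v)"
    using assms(1) unfolding pos_def_def by blast
  also have "\<dots> = u \<bullet> ((l *\<^sub>R Y) *v u) + u \<bullet> (transpose W *v v)
      + v \<bullet> (W *v u + Y *v v)"
    by (simp only: block_matrix_join_vec inner_join_vec inner_add_right)
  also have "Y *v v = - ((Y ** P) *v (W *v u))"
    by (simp only: v_def matrix_vector_mul_assoc[symmetric] vec.neg)
  also have "u \<bullet> (transpose W *v v) = (W *v u) \<bullet> v" by (rule transpose_inner)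
  finally show ?thesis
    by (simp add: assms(2) v_def quad_form_def scaleR_matrix_vector_assoc[symmetric])
qed

section \<open>The parameterization A + B K = I - 2 \<Gamma> P\<close>

lemma matrix_add_rdistrib: "(X + Y) ** Z = X ** Z + Y ** Z" for X Y :: "'a::semiring_1^'n^'m"
  by (simp add: vec_eq_iff matrix_matrix_mult_def sum.distrib distrib_right)

lemma matrix_diff_rdistrib: "(X - Y) ** Z = X ** Z - Y ** Z" for X Y :: "'a::ring_1^'n^'m"
  by (simp add: vec_eq_iff matrix_matrix_mult_def sum_subtractf left_diff_distrib)

lemma scaleR_matrix_mult: "(c *\<^sub>R X) ** Z = c *\<^sub>R (X ** Z)" for X :: "real^'n^'m"
  by (simp add: vec_eq_iff matrix_matrix_mult_def sum_distrib_left mult.assoc)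

lemma gradient_descent_systemI:
  assumes "symmetric_matrix P" "pos_def P" "pos_def G" "L = mat 1 - 2 *\<^sub>R (G ** P)"
  shows "gradient_descent_system G P (\<lambda>x. L *v x)"
  unfolding gradient_descent_system_def using assms gradient_step_quad_form by blast

lemma stable_matrix_gradient_descent:
  fixes M :: "real^'n^'n"
  assumes "stable_matrix M"
  obtains P G where "symmetric_matrix P" "pos_def P" "pos_def G" "M = mat 1 - 2 *\<^sub>R (G ** P)"
proof -
  obtain P where sym: "symmetric_matrix P" and pos: "pos_def P"
    and step: "\<And>w. quad_form P (M *v w) = quad_form P w - w \<bullet> w"
    using stable_matrix_Lyapunov[OF assms] by metis
  note P = pos_def_inverse[OF pos sym]
  define Q where "Q = matrix_inv P"
  \<comment> \<open>This solves \<open>M = mat 1 - 2 *\<^sub>R (G ** P)\<close> for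
    \<open>G\<close>.\<close>
  define G where "G = (1/2) *\<^sub>R ((mat 1 - M) ** Q)"
  have "pos_def G" unfolding pos_def_def
  proof (intro allI impI)
    fix z :: "real^'n" assume "z \<noteq> 0"
    define w where "w = Q *v z"
    have z: "z = P *v w" by (simp add: w_def Q_def matrix_vector_mul_assoc P)
    with \<open>z \<noteq> 0\<close> have "w \<noteq> 0" by auto
    have Gz: "G *v z = (1/2) *\<^sub>R (w - M *v w)"
      by (simp add: G_def w_def scaleR_matrix_vector_assoc[symmetric] matrix_vector_mul_assoc[symmetric]
          matrix_vector_mult_diff_rdistrib)
    \<comment> \<open>Expanding the square bounds the cross term by the mean of the forms at
      \<open>w\<close> and \<open>M *v w\<close>; the Lyapunov identity puts that mean strictly
      below \<open>quad_form P w\<close>.\<close>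
    have "0 \<le> quad_form P (w - M *v w)"
      using pos unfolding pos_def_def quad_form_def by (cases "w - M *v w = 0") (auto intro: less_imp_le)
    also have "\<dots> = quad_form P w + quad_form P (M *v w) - 2 * (w \<bullet> (P *v (M *v w)))"
      using symmetric_matrix_inner[OF sym, of "M *v w" w]
      by (simp add: quad_form_def matrix_vector_mult_diff_distrib inner_diff_left inner_diff_right inner_commute)
    finally have "2 * (w \<bullet> (P *v (M *v w))) \<le> 2 * quad_form P w - w \<bullet> w"
      using step[of w] by simp
    then have "w \<bullet> (P *v (M *v w)) < quad_form P w"
      using \<open>w \<noteq> 0\<close> inner_gt_zero_iff[of w] by linarith
    moreover have "z \<bullet> (G *v z) = (quad_form P w - w \<bullet> (P *v (M *v w))) / 2"
      unfolding Gz by (simp add: z symmetric_matrix_inner[OF sym] quad_form_def inner_diff_right)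
    ultimately show "0 < z \<bullet> (G *v z)" by simp
  qed
  moreover have "M = mat 1 - 2 *\<^sub>R (G ** P)"
    by (simp add: G_def Q_def scaleR_matrix_mult matrix_mul_assoc[symmetric] P)
  ultimately show thesis using that sym pos by blast
qed

text \<open>The equation says that the off-diagonal block \<open>Y - 2 *\<^sub>R G\<close> is the
  closed-loop matrix times \<open>Y\<close>. The Schur inequality at \<open>u\<close> is therefore
  the contraction inequality at \<open>Y *v u\<close>.\<close>

lemma gradient_descent_LMI:
  fixes A Y G :: "real^'n^'n" and B :: "real^'m^'n"
  assumes "symmetric_matrix Y" "pos_def Y" "pos_def G"
    and LMI: "pos_def (block_matrix (l *\<^sub>R Y) (transpose (Y - 2 *\<^sub>R G)) (Y - 2 *\<^sub>R G) Y)"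
    and eq: "A ** Y + B ** (K ** Y) = Y - 2 *\<^sub>R G"
  shows "A + B ** K = mat 1 - 2 *\<^sub>R (G ** matrix_inv Y)"
    and "contractive l (matrix_inv Y) (\<lambda>x. (A + B ** K) *v x)"
proof -
  define P where "P = matrix_inv Y"
  define L where "L = A + B ** K"
  note inv = pos_def_inverse[OF assms(2,1), folded P_def]
  have LY: "L ** Y = Y - 2 *\<^sub>R G"
    using eq by (simp add: L_def matrix_mul_assoc matrix_add_rdistrib)
  have "L = (L ** Y) ** P" by (simp add: matrix_mul_assoc[symmetric] inv)
  also have "\<dots> = mat 1 - 2 *\<^sub>R (G ** P)"
    by (simp add: LY matrix_diff_rdistrib inv scaleR_matrix_mult)
  finally show "A + B ** K = mat 1 - 2 *\<^sub>R (G ** matrix_inv Y)" by (simp add: L_def P_def)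
  have "quad_form P (L *v x) \<le> l * quad_form P x" for x
  proof (cases "x = 0")
    case False
    define u where "u = P *v x"
    have x: "x = Y *v u" by (simp add: u_def matrix_vector_mul_assoc inv)
    with False have "u \<noteq> 0" by auto
    from pos_def_block_matrix_Schur[OF LMI inv(2) this]
    have "quad_form P (L *v x) < l * quad_form Y u"
      by (simp add: x LY[symmetric] matrix_vector_mul_assoc)
    also have "quad_form Y u = quad_form P x"
      by (simp add: quad_form_def u_def matrix_vector_mul_assoc inv inner_commute)
    finally show ?thesis by simp
  qed (simp add: quad_form_def)
  then show "contractive l (matrix_inv Y) (\<lambda>x. (A + B ** K) *v x)"
    by (simp add: contractive_def L_def P_def)
qed

lemma closed_loop_trajectory_iff:
  "closed_loop_trajectory A B K x \<longleftrightarrow> (\<forall>k. x (Suc k) = (A + B ** K) *v x k)"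
  unfolding closed_loop_trajectory_def
  by (auto simp: matrix_vector_mult_add_rdistrib matrix_vector_mul_assoc[symmetric]
      intro!: exI[of _ "\<lambda>k. K *v x k"])

theorem theorem1:
  fixes A :: "real^'n^'n" and B :: "real^'m^'n"
  assumes "stabilizable A B"
  shows "(\<forall>(l::real) (G::real^'n^'n) (Y::real^'n^'n) (F::real^'n^'m).
            0 < l \<and> l \<le> 1 \<and> pos_def G \<and> symmetric_matrix Y \<and> pos_def Y \<and>
            pos_def (block_matrix (l *\<^sub>R Y) (transpose (Y - 2 *\<^sub>R G)) (Y - 2 *\<^sub>R G) Y) \<and>
            A ** Y + B ** F = Y - 2 *\<^sub>R G
            \<longrightarrow> (\<exists>!K::real^'n^'m. F = K ** Y) \<and>
                (\<forall>(P::real^'n^'n) (K::real^'n^'m). P = matrix_inv Y \<and> F = K ** Y \<longrightarrow>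
                   (\<forall>x::nat \<Rightarrow> real^'n. closed_loop_trajectory A B K x \<longrightarrow>
                      (\<forall>k. gradient_step G (quad_form P) (x k) (x (Suc k)))) \<and>
                   contractive l P (\<lambda>x. (A + B ** K) *v x) \<and>
                   gradient_descent_system G P (\<lambda>x. (A + B ** K) *v x) \<and>
                   A + B ** K = mat 1 - 2 *\<^sub>R (G ** P)))
       \<and> (\<forall>K::real^'n^'m. stable_matrix (A + B ** K) \<longrightarrow>
            (\<exists>(P::real^'n^'n) (G::real^'n^'n).
               symmetric_matrix P \<and> pos_def P \<and> pos_def G \<and>
               gradient_descent_system G P (\<lambda>x. (A + B ** K) *v x) \<and>
               A + B ** K = mat 1 - 2 *\<^sub>R (G ** P)))"
proof (rule conjI; intro allI impI, (elim conjE)?)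
  fix l :: real and G Y F
  assume G: "pos_def G" and Y: "symmetric_matrix Y" "pos_def Y"
    and LMI: "pos_def (block_matrix (l *\<^sub>R Y) (transpose (Y - 2 *\<^sub>R G)) (Y - 2 *\<^sub>R G) Y)"
    and eq: "A ** Y + B ** F = Y - 2 *\<^sub>R G"
  note inv = pos_def_inverse[OF Y(2,1)]
  \<comment> \<open>Invertibility of \<open>Y\<close> is what makes \<open>F = K ** Y\<close> a
    definition of the gain.\<close>
  have "\<exists>!K. F = K ** Y"
    by (rule ex1I[of _ "F ** matrix_inv Y"]) (auto simp: matrix_mul_assoc[symmetric] inv)
  moreover have "(\<forall>x. closed_loop_trajectory A B K x \<longrightarrow>
            (\<forall>k. gradient_step G (quad_form P) (x k) (x (Suc k)))) \<and>
          contractive l P (\<lambda>x. (A + B ** K) *v x) \<and>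
          gradient_descent_system G P (\<lambda>x. (A + B ** K) *v x) \<and>
          A + B ** K = mat 1 - 2 *\<^sub>R (G ** P)"
    if P: "P = matrix_inv Y" and K: "F = K ** Y" for P K
  proof -
    have L: "A + B ** K = mat 1 - 2 *\<^sub>R (G ** P)"
      and "contractive l P (\<lambda>x. (A + B ** K) *v x)"
      using gradient_descent_LMI[OF Y G LMI eq[unfolded K]] by (simp_all add: P)
    moreover have "gradient_descent_system G P (\<lambda>x. (A + B ** K) *v x)"
      using inv(3,4) G L by (intro gradient_descent_systemI) (simp_all add: P)
    ultimately show ?thesis
      by (simp add: closed_loop_trajectory_iff gradient_descent_system_def)
  qed
  ultimately show "(\<exists>!K. F = K ** Y) \<and> (\<forall>P K. P = matrix_inv Y \<and> F = K ** Y \<longrightarrow>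
          (\<forall>x. closed_loop_trajectory A B K x \<longrightarrow>
            (\<forall>k. gradient_step G (quad_form P) (x k) (x (Suc k)))) \<and>
          contractive l P (\<lambda>x. (A + B ** K) *v x) \<and>
          gradient_descent_system G P (\<lambda>x. (A + B ** K) *v x) \<and>
          A + B ** K = mat 1 - 2 *\<^sub>R (G ** P))"
    by blast
next
  fix K assume "stable_matrix (A + B ** K)"
  then show "\<exists>P G. symmetric_matrix P \<and> pos_def P \<and> pos_def G \<and>
      gradient_descent_system G P (\<lambda>x. (A + B ** K) *v x) \<and>
      A + B ** K = mat 1 - 2 *\<^sub>R (G ** P)"
    by (metis stable_matrix_gradient_descent gradient_descent_systemI)
qed

end
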